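(* Let $n\ge 2$ and let $C_1,C_2,\ldots,C_n,C_{n+1}=C_1$ be a closed chain of circles in the Euclidean plane such that for each $i=1,\ldots,n$ the circles $C_i$ and $C_{i+1}$ either intersect in two points or touch each other. For $i=1,\ldots,n$ let $A_i$ be a common point of $C_i$ and $C_{i+1}$, and let $\varphi_{A_i}:C_i\to C_{i+1}$ be the pivot map with pivot $A_i$. Let $\varphi:=\varphi_{A_n}\circ\cdots\circ\varphi_{A_2}\circ\varphi_{A_1}:C_1\to C_1$. If $\varphi(X)=X$ for one point $X\in C_1$, then $\varphi$ is the identity map on $C_1$.
   Context: Pivot map: let $C,C'$ be two distinct circles which intersect in two points or touch each other, and let $A$ be a common point of $C$ and $C'$. The map $\varphi_A:C\to C'$ is defined as follows. If $X\in C$, $X\ne A$, then $\varphi_A(X)$ is the point of $C'$ such that $X,A,\varphi_A(X)$ are collinear, i.e. the second intersection point of the line $XA$ with $C'$ (equal to $A$ if this line is tangent to $C'$ at $A$). If $X=A$, then $\varphi_A(X)$ is the point of $C'$ such that the line through $A$ and $\varphi_A(X)$ is the tangent to $C$ at $A$, i.e. the second intersection of this tangent with $C'$ (equal to $A$ if $C,C'$ touch at $A$). The point $A$ is called the pivot. Indices are read cyclically modulo $n$; non-neighbouring circles of the chain are not subject to any condition. *)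

theory Defs
  imports "HOL-Analysis.Analysis"
begin

type_synonym point = "real^2"

definition is_circle :: "point set \<Rightarrow> bool" where
  "is_circle C \<longleftrightarrow> (\<exists>c r. r > 0 \<and> C = sphere c r)"

definition is_line :: "point set \<Rightarrow> bool" where
  "is_line l \<longleftrightarrow> affine l \<and> aff_dim l = 1"

definition tangent_at :: "point set \<Rightarrow> point set \<Rightarrow> point \<Rightarrow> bool" where
  "tangent_at l C A \<longleftrightarrow> is_line l \<and> l \<inter> C = {A}"

definition tangent_line :: "point set \<Rightarrow> point \<Rightarrow> point set" where
  "tangent_line C A = (THE l. tangent_at l C A)"

definition circles_touch :: "point set \<Rightarrow> point set \<Rightarrow> bool" where
  "circles_touch C C' \<longleftrightarrow> C \<noteq> C' \<and> (\<exists>A l. tangent_at l C A \<and> tangent_at l C' A)"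

text \<open>The equation below covers both cases: \<open>Y \<noteq> A\<close> for a secant, and
  \<open>Y = A\<close> if \<open>l\<close> is tangent to \<open>C\<close> at \<open>A\<close>. Existence and uniqueness are
  shown in \<open>second_intersection_ex1\<close>.\<close>

definition second_intersection :: "point set \<Rightarrow> point set \<Rightarrow> point \<Rightarrow> point" where
  "second_intersection l C A = (THE Y. l \<inter> C = {A, Y})"

definition pivot_map :: "point set \<Rightarrow> point set \<Rightarrow> point \<Rightarrow> point \<Rightarrow> point" where
  "pivot_map C C' A X =
     second_intersection (if X = A then tangent_line C A else affine hull {X, A}) C' A"

text \<open>\<open>pivot_chain C A n\<close> is the composition
  \<open>\<phi>\<^sub>n \<circ> \<dots> \<circ> \<phi>\<^sub>2 \<circ> \<phi>\<^sub>1\<close> with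
  \<open>\<phi>\<^sub>i = pivot_map (C i) (C (i+1)) (A i)\<close>, so that \<open>\<phi>\<^sub>1\<close> is applied first.\<close>

definition pivot_chain ::
  "(nat \<Rightarrow> point set) \<Rightarrow> (nat \<Rightarrow> point) \<Rightarrow> nat \<Rightarrow> point \<Rightarrow> point" where
  "pivot_chain C A n = fold (\<lambda>i. pivot_map (C i) (C (i + 1)) (A i)) [1..<n + 1]"

lemma is_line_through:
  assumes "is_line l" "A \<in> l"
  obtains u where "u \<noteq> 0" "l = range (\<lambda>t. A + t *\<^sub>R u)"
proof -
  have "l \<noteq> {A}"
    using assms by (auto simp: is_line_def)
  then obtain B where B: "B \<in> l" "B \<noteq> A"
    using assms by blast
  have "affine hull {A, B} \<subseteq> l"
    using assms B by (simp add: is_line_def hull_minimal)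
  moreover have "aff_dim (affine hull {A, B}) = aff_dim l"
    using assms B by (simp add: is_line_def aff_dim_2)
  ultimately have "affine hull {A, B} = l"
    using assms by (intro affine_dim_equal) (auto simp: is_line_def)
  then have "l = range (\<lambda>t. A + t *\<^sub>R (B - A))"
    by (auto simp: affine_hull_2_alt)
  with B show ?thesis
    by (intro that[of "B - A"]) auto
qed

lemma is_line_affine_hull: "X \<noteq> A \<Longrightarrow> is_line (affine hull {X, A})"
  by (simp add: is_line_def aff_dim_2)

lemma line_Int_sphere:
  fixes u A c :: point
  assumes u: "u \<noteq> 0" and A: "A \<in> sphere c r"
  shows "range (\<lambda>t. A + t *\<^sub>R u) \<inter> sphere c r =
           {A, A - (2 * (u \<bullet> (A - c)) / (u \<bullet> u)) *\<^sub>R u}"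
proof -
  have r: "r \<ge> 0" "(A - c) \<bullet> (A - c) = r\<^sup>2"
    using A by (auto simp: dist_norm norm_minus_commute power2_norm_eq_inner[symmetric])
  have "A + t *\<^sub>R u \<in> sphere c r \<longleftrightarrow> t = 0 \<or> t = - (2 * (u \<bullet> (A - c)) / (u \<bullet> u))" for t
  proof -
    have "A + t *\<^sub>R u \<in> sphere c r \<longleftrightarrow> (norm (A + t *\<^sub>R u - c))\<^sup>2 = r\<^sup>2"
      using r by (simp add: dist_norm norm_minus_commute power2_eq_iff_nonneg)
    also have "(norm (A + t *\<^sub>R u - c))\<^sup>2 = ((A - c) + t *\<^sub>R u) \<bullet> ((A - c) + t *\<^sub>R u)"
      by (simp add: power2_norm_eq_inner algebra_simps)
    also have "\<dots> = r\<^sup>2 + t * (2 * (u \<bullet> (A - c)) + t * (u \<bullet> u))"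
      unfolding inner_add_left inner_add_right r(2)
      by (simp add: inner_commute algebra_simps)
    also have "\<dots> = r\<^sup>2 \<longleftrightarrow> t = 0 \<or> t = - (2 * (u \<bullet> (A - c)) / (u \<bullet> u))"
    proof -
      have "t * (2 * (u \<bullet> (A - c)) + t * (u \<bullet> u)) = 0 \<longleftrightarrow>
              t = 0 \<or> 2 * (u \<bullet> (A - c)) + t * (u \<bullet> u) = 0"
        by (rule mult_eq_0_iff)
      also have "2 * (u \<bullet> (A - c)) + t * (u \<bullet> u) = 0 \<longleftrightarrow>
                   t = - (2 * (u \<bullet> (A - c)) / (u \<bullet> u))"
      proof -
        have "u \<bullet> u \<noteq> 0"
          using u by simp
        from nonzero_eq_divide_eq[OF this, of t "- (2 * (u \<bullet> (A - c)))"] show ?thesis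
          unfolding minus_divide_left by linarith
      qed
      finally show ?thesis
        by simp
    qed
    finally show ?thesis .
  qed
  then have "range (\<lambda>t. A + t *\<^sub>R u) \<inter> sphere c r =
      (\<lambda>t. A + t *\<^sub>R u) ` {0, - (2 * (u \<bullet> (A - c)) / (u \<bullet> u))}"
    by blast
  then show ?thesis
    by simp
qed

lemma second_intersection_ex1:
  assumes "is_circle C" "is_line l" "A \<in> l" "A \<in> C"
  shows "\<exists>!Y. l \<inter> C = {A, Y}"
proof -
  obtain u where u: "u \<noteq> 0" "l = range (\<lambda>t. A + t *\<^sub>R u)"
    using assms is_line_through by blast
  obtain c r where "C = sphere c r"
    using assms by (auto simp: is_circle_def)
  then have "\<exists>Y. l \<inter> C = {A, Y}"
    using line_Int_sphere[OF u(1)] assms u by blast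
  then show ?thesis
    by (auto simp: doubleton_eq_iff)
qed

text \<open>The line meeting a circle only in \<open>A\<close> is the perpendicular to the radius at \<open>A\<close>.\<close>

lemma tangent_at_sphere_iff:
  assumes r: "r > 0" and A: "A \<in> sphere c r"
  shows "tangent_at l (sphere c r) A \<longleftrightarrow> l = {P. (A - c) \<bullet> P = (A - c) \<bullet> A}"
proof -
  let ?H = "{P. (A - c) \<bullet> P = (A - c) \<bullet> A}"
  have "A - c \<noteq> 0"
    using r A by auto
  then have H: "is_line ?H"
    by (simp add: is_line_def affine_hyperplane)
  have tan: "tangent_at m (sphere c r) A \<longleftrightarrow> m \<subseteq> ?H" if m: "is_line m" "A \<in> m" for m
  proof -
    obtain u where u: "u \<noteq> 0" "m = range (\<lambda>t. A + t *\<^sub>R u)"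
      using m is_line_through by blast
    have "tangent_at m (sphere c r) A \<longleftrightarrow> u \<bullet> (A - c) = 0"
      using line_Int_sphere[OF u(1) A] m u by (auto simp: tangent_at_def)
    also have "\<dots> \<longleftrightarrow> m \<subseteq> ?H"
    proof
      assume "m \<subseteq> ?H"
      moreover have "A + 1 *\<^sub>R u \<in> m"
        unfolding u(2) by blast
      ultimately have "A + 1 *\<^sub>R u \<in> ?H"
        by blast
      then show "u \<bullet> (A - c) = 0"
        by (simp add: inner_add_right inner_commute)
    next
      assume "u \<bullet> (A - c) = 0"
      then show "m \<subseteq> ?H"
        unfolding u(2) by (auto simp: inner_add_right inner_commute)
    qed
    finally show ?thesis .
  qed
  show ?thesis
  proof
    assume l: "tangent_at l (sphere c r) A"
    then have *: "is_line l" "A \<in> l"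
      by (auto simp: tangent_at_def)
    then have "l \<subseteq> ?H"
      using tan l by blast
    then show "l = ?H"
      using * H by (intro affine_dim_equal) (auto simp: is_line_def)
  next
    assume "l = ?H"
    then show "tangent_at l (sphere c r) A"
      using tan[OF H] by simp
  qed
qed

lemma tangent_line_sphere:
  assumes "r > 0" "A \<in> sphere c r"
  shows "tangent_line (sphere c r) A = {P. (A - c) \<bullet> P = (A - c) \<bullet> A}"
  unfolding tangent_line_def tangent_at_sphere_iff[OF assms] by simp

lemma tangent_at_tangent_line:
  assumes "is_circle C" "A \<in> C"
  shows "tangent_at (tangent_line C A) C A"
  using assms by (auto simp: is_circle_def tangent_line_sphere tangent_at_sphere_iff)

lemma pivot_map_spec:
  assumes "is_circle C" "is_circle C'" "A \<in> C" "A \<in> C'"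
  shows "(if X = A then tangent_line C A else affine hull {X, A}) \<inter> C' = {A, pivot_map C C' A X}"
proof -
  let ?l = "if X = A then tangent_line C A else affine hull {X, A}"
  have "is_line ?l" "A \<in> ?l"
    using tangent_at_tangent_line[OF assms(1,3)]
    by (auto simp: tangent_at_def is_line_affine_hull hull_inc)
  then show ?thesis
    unfolding pivot_map_def second_intersection_def
    using theI'[OF second_intersection_ex1] assms by blast
qed

lemma pivot_map_in_circle:
  assumes "is_circle C" "is_circle C'" "A \<in> C" "A \<in> C'"
  shows "pivot_map C C' A X \<in> C'"
  using pivot_map_spec[OF assms, of X] by blast

end

theory Submission
  imports Defs
begin

text \<open>In complex coordinates the pivot map between circles with centres \<open>c\<close>, \<open>c'\<close> is the
  restriction of the spiral similarity
  \<open>X \<mapsto> c' + (cnj (A - c') / cnj (A - c)) * (X - c)\<close>, tangent cases included.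
  Hence the composition along a closed chain has the form \<open>X \<mapsto> c\<^sub>1 + k * (X - c\<^sub>1)\<close>,
  and a fixed point different from the centre forces \<open>k = 1\<close>.\<close>

definition cplx :: "point \<Rightarrow> complex" where
  "cplx P = Complex (P $ 1) (P $ 2)"

lemma cplx_eq_iff [simp]: "cplx P = cplx Q \<longleftrightarrow> P = Q"
  by (simp add: cplx_def vec_eq_iff forall_2)

lemma cplx_add: "cplx (P + Q) = cplx P + cplx Q"
  and cplx_diff: "cplx (P - Q) = cplx P - cplx Q"
  and cplx_scaleR: "cplx (t *\<^sub>R P) = of_real t * cplx P"
  by (simp_all add: cplx_def complex_eq_iff)

text \<open>This is twice the real part of \<open>cplx P * cnj (cplx Q)\<close>. In this form
  orthogonality and the chord parameter become polynomial identities in complex numbers and their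
  conjugates.\<close>

lemma inner_conv_cplx:
  "complex_of_real (2 * (P \<bullet> Q)) = cplx P * cnj (cplx Q) + cnj (cplx P) * cplx Q"
  by (simp add: cplx_def complex_eq_iff inner_vec_def sum_2)

lemma cplx_diff_mult_cnj:
  assumes "P \<in> sphere c r"
  shows "cplx (P - c) * cnj (cplx (P - c)) = of_real (r\<^sup>2)"
proof -
  have "(P - c) \<bullet> (P - c) = r\<^sup>2"
    using assms by (auto simp: dist_norm norm_minus_commute power2_norm_eq_inner[symmetric])
  with inner_conv_cplx[of "P - c" "P - c"] show ?thesis
    by (simp add: mult.commute)
qed

text \<open>The perpendicular bisector of a chord passes through the centre, so the radius vector of
  the second endpoint is the reflection of \<open>A - c'\<close> in the line through the origin
  perpendicular to \<open>u\<close>. With \<open>w = cplx u\<close>, this reflection is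
  \<open>z\<close> to \<open>- (w / cnj w) * cnj z\<close>, stated here without the
  division.\<close>

lemma cplx_pivot_map_direction:
  assumes circ: "is_circle C" "A \<in> C" "A \<in> sphere c' r'" "r' > 0"
    and l: "(if X = A then tangent_line C A else affine hull {X, A}) = range (\<lambda>t. A + t *\<^sub>R u)"
    and u: "u \<noteq> 0"
  shows "cplx (pivot_map C (sphere c' r') A X - c') * cnj (cplx u)
           = - cplx u * cnj (cplx (A - c'))"
proof -
  define t where "t = 2 * (u \<bullet> (A - c')) / (u \<bullet> u)"
  have "is_circle (sphere c' r')"
    using circ by (auto simp: is_circle_def)
  from pivot_map_spec[OF circ(1) this circ(2,3), of X]
  have Y: "pivot_map C (sphere c' r') A X = A - t *\<^sub>R u"
    \<comment> \<open>Equality of the doubletons forces equality of the second points even when one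
      of them is \<open>A\<close>, so tangency to the target circle needs no separate case.\<close>
    unfolding l t_def line_Int_sphere[OF u circ(3)] by (metis doubleton_eq_iff)
  have "u \<bullet> u \<noteq> 0"
    using u by simp
  then have "t * (2 * (u \<bullet> u)) = 2 * (2 * (u \<bullet> (A - c')))"
    by (simp add: t_def)
  then have "of_real t * complex_of_real (2 * (u \<bullet> u))
               = 2 * complex_of_real (2 * (u \<bullet> (A - c')))"
    by (metis of_real_mult of_real_numeral)
  then have "2 * (of_real t * cplx u * cnj (cplx u))
      = 2 * (cplx u * cnj (cplx (A - c')) + cnj (cplx u) * cplx (A - c'))"
    unfolding inner_conv_cplx by (simp add: algebra_simps)
  then have "of_real t * cplx u * cnj (cplx u)
      = cplx u * cnj (cplx (A - c')) + cnj (cplx u) * cplx (A - c')"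
    by (metis mult_cancel_left zero_neq_numeral)
  then show ?thesis
    unfolding Y cplx_diff cplx_scaleR by (simp add: algebra_simps)
qed

text \<open>The points \<open>A\<close> and \<open>X\<close> span a chord of the first circle,
  \<open>A\<close> and the image a chord of the second, both along the same line. Each chord
  determines the quotient of \<open>cplx u\<close> by its conjugate; eliminating it leaves a factor
  independent of \<open>X\<close>.\<close>

lemma cplx_pivot_map:
  assumes r: "r > 0" "r' > 0"
    and A: "A \<in> sphere c r" "A \<in> sphere c' r'" and X: "X \<in> sphere c r"
  shows "cplx (pivot_map (sphere c r) (sphere c' r') A X - c')
           = cnj (cplx (A - c') / cplx (A - c)) * cplx (X - c)"
proof -
  let ?l = "if X = A then tangent_line (sphere c r) A else affine hull {X, A}"
  have circ: "is_circle (sphere c r)"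
    using r by (auto simp: is_circle_def)
  have a: "cnj (cplx (A - c)) \<noteq> 0"
    using cplx_diff_mult_cnj[OF A(1)] r by auto
  \<comment> \<open>The relation \<open>dir\<close> is the chord relation for the first circle; for
    \<open>X = A\<close> it says that the tangent is perpendicular to the radius.\<close>
  obtain u where u: "u \<noteq> 0" "?l = range (\<lambda>t. A + t *\<^sub>R u)"
    and dir: "cplx u * cnj (cplx (A - c)) = - cplx (X - c) * cnj (cplx u)"
  proof (cases "X = A")
    case True
    have "tangent_at (tangent_line (sphere c r) A) (sphere c r) A"
      using tangent_at_tangent_line circ A by blast
    then obtain u where u: "u \<noteq> 0" "tangent_line (sphere c r) A = range (\<lambda>t. A + t *\<^sub>R u)"
      using is_line_through by (metis Int_iff insertI1 tangent_at_def)
    have "A + 1 *\<^sub>R u \<in> tangent_line (sphere c r) A"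
      unfolding u by blast
    then have "u \<bullet> (A - c) = 0"
      by (simp add: tangent_line_sphere r A(1)[simplified] inner_add_right inner_commute)
    with inner_conv_cplx[of u "A - c"]
    have "cplx u * cnj (cplx (A - c)) = - cplx (A - c) * cnj (cplx u)"
      by (simp add: eq_neg_iff_add_eq_0 mult.commute)
    with u True show ?thesis
      by (intro that) auto
  next
    case False
    have "?l = range (\<lambda>t. A + t *\<^sub>R (X - A))"
      using False by (auto simp: insert_commute[of X A] affine_hull_2_alt)
    moreover have "cplx (X - A) * cnj (cplx (A - c)) = - cplx (X - c) * cnj (cplx (X - A))"
    proof -
      have "cplx (X - A) = cplx (X - c) - cplx (A - c)"
        by (simp add: cplx_diff)
      \<comment> \<open>Both sides expand to \<open>cplx (X - c) * cnj (cplx (A - c))\<close> minus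
        the squared radius.\<close>
      with cplx_diff_mult_cnj[OF A(1)] cplx_diff_mult_cnj[OF X] show ?thesis
        by (simp add: left_diff_distrib right_diff_distrib)
    qed
    ultimately show ?thesis
      using False by (intro that[of "X - A"]) simp_all
  qed
  have piv: "cplx (pivot_map (sphere c r) (sphere c' r') A X - c') * cnj (cplx u)
           = - cplx u * cnj (cplx (A - c'))"
    using cplx_pivot_map_direction circ A r u by blast
  \<comment> \<open>The extra factor \<open>cnj (cplx u)\<close> allows \<open>piv\<close> and then
    \<open>dir\<close> to be substituted; it is cancelled at the end.\<close>
  have "cplx (pivot_map (sphere c r) (sphere c' r') A X - c') * cnj (cplx (A - c)) * cnj (cplx u)
      = cplx (pivot_map (sphere c r) (sphere c' r') A X - c') * cnj (cplx u) * cnj (cplx (A - c))"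
    by (simp only: mult_ac)
  also have "\<dots> = - (cplx u * cnj (cplx (A - c))) * cnj (cplx (A - c'))"
    unfolding piv by simp
  also have "\<dots> = cnj (cplx (A - c')) * cplx (X - c) * cnj (cplx u)"
    unfolding dir by (simp add: algebra_simps)
  finally have "cplx (pivot_map (sphere c r) (sphere c' r') A X - c') * cnj (cplx (A - c))
        = cnj (cplx (A - c')) * cplx (X - c)"
    using u(1) cplx_eq_iff[of u 0] by (simp add: cplx_def zero_complex.code[symmetric])
  with a show ?thesis
    by (simp add: field_simps)
qed

lemma pivot_chain_0: "pivot_chain C A 0 X = X"
  by (simp add: pivot_chain_def)

lemma pivot_chain_Suc:
  "pivot_chain C A (Suc m) X = pivot_map (C (Suc m)) (C (Suc m + 1)) (A (Suc m)) (pivot_chain C A m X)"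
  by (simp add: pivot_chain_def)

text \<open>The factors of the single pivot maps multiply, and \<open>k\<close> is chosen before
  \<open>X\<close> because none of them depends on the point. Membership in the last circle is
  carried along since \<open>cplx_pivot_map\<close> requires it at the next step.\<close>

lemma pivot_chain_linear:
  assumes C: "\<And>i. i \<in> {1..n + 1} \<Longrightarrow> r i > 0 \<and> C i = sphere (c i) (r i)"
    and A: "\<And>i. i \<in> {1..n} \<Longrightarrow> A i \<in> C i \<inter> C (i + 1)"
  shows "\<exists>k. \<forall>X \<in> C 1. pivot_chain C A n X \<in> C (n + 1) \<and>
           cplx (pivot_chain C A n X - c (n + 1)) = k * cplx (X - c 1)"
  using assms
proof (induction n)
  case 0
  show ?case
    by (rule exI[of _ 1]) (simp add: pivot_chain_0)
next
  case (Suc m)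
  have "\<exists>k. \<forall>X \<in> C 1. pivot_chain C A m X \<in> C (m + 1) \<and>
           cplx (pivot_chain C A m X - c (m + 1)) = k * cplx (X - c 1)"
    by (rule Suc.IH) (use Suc.prems in auto)
  then obtain k where k: "\<And>X. X \<in> C 1 \<Longrightarrow> pivot_chain C A m X \<in> C (m + 1)"
    "\<And>X. X \<in> C 1 \<Longrightarrow> cplx (pivot_chain C A m X - c (m + 1)) = k * cplx (X - c 1)"
    by blast
  let ?B = "A (Suc m)"
  let ?q = "cnj (cplx (?B - c (Suc m + 1)) / cplx (?B - c (Suc m)))"
  have S: "r (Suc m) > 0" "C (Suc m) = sphere (c (Suc m)) (r (Suc m))"
    "r (Suc m + 1) > 0" "C (Suc m + 1) = sphere (c (Suc m + 1)) (r (Suc m + 1))"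
    using Suc.prems(1)[of "Suc m"] Suc.prems(1)[of "Suc m + 1"] by auto
  have B: "?B \<in> C (Suc m)" "?B \<in> C (Suc m + 1)"
    using Suc.prems(2)[of "Suc m"] by auto
  show ?case
  proof (intro exI[of _ "?q * k"] ballI conjI)
    fix X assume X: "X \<in> C 1"
    have "is_circle (C (Suc m))" "is_circle (C (Suc m + 1))"
      using S unfolding is_circle_def by blast+
    from pivot_map_in_circle[OF this B]
    show "pivot_chain C A (Suc m) X \<in> C (Suc m + 1)"
      unfolding pivot_chain_Suc by blast
    have "cplx (pivot_chain C A (Suc m) X - c (Suc m + 1))
            = ?q * cplx (pivot_chain C A m X - c (Suc m))"
      unfolding pivot_chain_Suc S(2,4)
      by (rule cplx_pivot_map) (use S B k(1)[OF X] in auto)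
    then show "cplx (pivot_chain C A (Suc m) X - c (Suc m + 1)) = ?q * k * cplx (X - c 1)"
      using k(2)[OF X] by simp
  qed
qed

theorem theorem2:
  fixes n :: nat
    and C :: "nat \<Rightarrow> point set"
    and A :: "nat \<Rightarrow> point"
    and X :: point
  assumes "n \<ge> 2"
    and "\<And>i. i \<in> {1..n} \<Longrightarrow> is_circle (C i)"
    and "C (n + 1) = C 1"
    and "\<And>i. i \<in> {1..n} \<Longrightarrow>
           card (C i \<inter> C (i + 1)) = 2 \<or> circles_touch (C i) (C (i + 1))"
    and "\<And>i. i \<in> {1..n} \<Longrightarrow> A i \<in> C i \<inter> C (i + 1)"
    and "X \<in> C 1"
    and "pivot_chain C A n X = X"
  shows "\<forall>Y \<in> C 1. pivot_chain C A n Y = Y"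
proof -
  \<comment> \<open>Centre and radius are chosen as functions of the circle, not of its index, so
    that \<open>C (n + 1) = C 1\<close> makes the first and last centres coincide.\<close>
  have "\<forall>S. \<exists>c r. is_circle S \<longrightarrow> r > 0 \<and> S = sphere c r"
    unfolding is_circle_def by blast
  then obtain c r where cr: "\<And>S. is_circle S \<Longrightarrow> r S > 0 \<and> S = sphere (c S) (r S)"
    by metis
  have "is_circle (C i)" if "i \<in> {1..n + 1}" for i
    using that assms(1-3) by (cases "i = n + 1") auto
  then have C: "r (C i) > 0 \<and> C i = sphere (c (C i)) (r (C i))" if "i \<in> {1..n + 1}" for i
    using cr that by blast
  from pivot_chain_linear[of n "\<lambda>i. r (C i)" C "\<lambda>i. c (C i)" A, OF C assms(5)]
  obtain k where k: "\<And>Y. Y \<in> C 1 \<Longrightarrow>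
      cplx (pivot_chain C A n Y - c (C 1)) = k * cplx (Y - c (C 1))"
    unfolding assms(3) by blast
  have "X \<in> sphere (c (C 1)) (r (C 1))" "r (C 1) > 0"
    using C[of 1] assms(6) by auto
  then have "cplx (X - c (C 1)) \<noteq> 0"
    using cplx_diff_mult_cnj by fastforce
  then have "k = 1"
    using k[OF assms(6)] assms(7) by simp
  then show ?thesis
    using k by simp
qed

end
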